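(* Let $(X,G)$ be a dynamical system, i.e. $X$ is a uniform space and $G$ is a subgroup of $\mathrm{Aut}(X)$. Then the asymptotic uniform complexity $\omega(X,G)$ and the mean topological matching number $\mu(X,G)$ satisfy $$\omega(X,G)\;\geq\;2-\mu(X,G).$$
   Context: Set notation: $\mathcal{P}(X)$ is the power set of $X$, $\mathcal{F}(X)$ the set of finite subsets of $X$, and $\mathcal{F}_{+}(X)=\mathcal{F}(X)\setminus\{\emptyset\}$. For $\mathcal{U},\mathcal{V}\subseteq\mathcal{P}(X)$, write $\mathcal{U}\preceq\mathcal{V}$ ("$\mathcal{V}$ refines $\mathcal{U}$") if every $V\in\mathcal{V}$ is contained in some $U\in\mathcal{U}$; put $\mathcal{U}\vee\mathcal{V}=\{U\cap V\mid U\in\mathcal{U},V\in\mathcal{V}\}$. For $S\subseteq X$ put $\mathrm{St}(S,\mathcal{U})=\bigcup\{U\in\mathcal{U}\mid U\cap S\neq\emptyset\}$, and $\mathcal{U}^{\ast}=\{\mathrm{St}(U,\mathcal{U})\mid U\in\mathcal{U}\}$; write $\mathcal{U}\preceq^{\ast}\mathcal{V}$ if $\mathcal{U}\preceq\mathcal{V}^{\ast}$. A covering of $X$ is a $\mathcal{U}\subseteq\mathcal{P}(X)$ with $\bigcup\mathcal{U}=X$. Uniform spaces (via coverings): a uniformity on $X$ is a non-empty set $\mathcal{D}$ of coverings of $X$ such that (1) if $\mathcal{U}\in\mathcal{D}$ and $\mathcal{V}$ is a covering of $X$ with $\mathcal{V}\preceq\mathcal{U}$, then $\mathcal{V}\in\mathcal{D}$;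 (2) for all $\mathcal{U},\mathcal{V}\in\mathcal{D}$ there is $\mathcal{W}\in\mathcal{D}$ with $\mathcal{U}\preceq^{\ast}\mathcal{W}$ and $\mathcal{V}\preceq^{\ast}\mathcal{W}$. A uniform space is a non-empty set $X$ with a uniformity, whose elements are called uniform coverings. $\mathcal{N}(X)$ is the set of finite uniform coverings of $X$. A map $f\colon X\to Y$ of uniform spaces is uniformly continuous if $f^{-1}(\mathcal{U})=\{f^{-1}(U)\mid U\in\mathcal{U}\}$ is a uniform covering of $X$ for each uniform covering $\mathcal{U}$ of $Y$. $\mathrm{Aut}(X)$ is the group of bijections $X\to X$ that are uniformly continuous with uniformly continuous inverse. For $g\in\mathrm{Aut}(X)$, $g(\mathcal{V})=\{g(V)\mid V\in\mathcal{V}\}$. Uniform complexity: for $\mathcal{U}\in\mathcal{N}(X)$, $N(\mathcal{U})=\inf\{|\mathcal{V}|\mid\mathcal{V}\in\mathcal{N}(X),\ \mathcal{U}\preceq\mathcal{V}\}$. Asymptotic uniform complexity: $$\omega(X,G)=\sup_{E\in\mathcal{F}(G)}\ \sup_{\mathcal{U}\in\mathcal{N}(X)}\ \inf\left\{\sup_{g\in E}\frac{N(\mathcal{V}\vee g(\mathcal{V}))}{N(\mathcal{V})}\ \middle|\ \mathcal{V}\in\mathcal{N}(X),\ \mathcal{U}\preceq\mathcal{V}\right\}.$$ Mean topological matching number: for $E,F\in\mathcal{F}(X)$ and $\mathcal{U}\subseteq\mathcal{P}(X)$, $\mu(E,F,\mathcal{U})$ is the maximum of $|D|$ over all injective maps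 $\phi\colon D\to F$ with $D\subseteq E$ such that for each $x\in D$ there is $U\in\mathcal{U}$ with $\{x,\phi(x)\}\subseteq U$. Then $$\mu(X,G)=\inf_{E\in\mathcal{F}(G)}\ \inf_{\mathcal{U}\in\mathcal{N}(X)}\ \sup_{F\in\mathcal{F}_{+}(X)}\ \inf_{g\in E}\frac{\mu(F,g(F),\mathcal{U})}{|F|}\in[0,1].$$ (Empty suprema/infima are taken in the extended reals; $E=\emptyset$ does not affect these quantities.) *)

theory Defs
  imports "HOL-Algebra.Bij" "HOL-Library.Extended_Real"
begin

section \<open>Coverings\<close>

definition covering :: "'a set \<Rightarrow> 'a set set \<Rightarrow> bool" where
  "covering X \<U> \<longleftrightarrow> \<U> \<subseteq> Pow X \<and> \<Union>\<U> = X"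

text \<open>\<open>\<U> \<preceq> \<V>\<close> means that \<open>\<V>\<close> refines \<open>\<U>\<close>: the finer family stands on the right.\<close>

definition refined_by :: "'a set set \<Rightarrow> 'a set set \<Rightarrow> bool" (infix "\<preceq>" 50) where
  "\<U> \<preceq> \<V> \<longleftrightarrow> (\<forall>V\<in>\<V>. \<exists>U\<in>\<U>. V \<subseteq> U)"

definition cover_join :: "'a set set \<Rightarrow> 'a set set \<Rightarrow> 'a set set" where
  "cover_join \<U> \<V> = {U \<inter> V | U V. U \<in> \<U> \<and> V \<in> \<V>}"

definition St :: "'a set \<Rightarrow> 'a set set \<Rightarrow> 'a set" where
  "St S \<U> = \<Union>{U \<in> \<U>. U \<inter> S \<noteq> {}}"

definition star :: "'a set set \<Rightarrow> 'a set set" where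
  "star \<U> = {St U \<U> | U. U \<in> \<U>}"

definition star_refined_by :: "'a set set \<Rightarrow> 'a set set \<Rightarrow> bool" (infix "\<preceq>\<^sup>*" 50) where
  "\<U> \<preceq>\<^sup>* \<V> \<longleftrightarrow> \<U> \<preceq> star \<V>"

section \<open>Uniform spaces and their automorphisms\<close>

definition covering_uniformity :: "'a set \<Rightarrow> 'a set set set \<Rightarrow> bool" where
  "covering_uniformity X \<D> \<longleftrightarrow>
     \<D> \<noteq> {} \<and> (\<forall>\<U>\<in>\<D>. covering X \<U>) \<and>
     (\<forall>\<U>\<in>\<D>. \<forall>\<V>. covering X \<V> \<and> \<V> \<preceq> \<U> \<longrightarrow> \<V> \<in> \<D>) \<and>
     (\<forall>\<U>\<in>\<D>. \<forall>\<V>\<in>\<D>. \<exists>\<W>\<in>\<D>. \<U> \<preceq>\<^sup>* \<W> \<and> \<V> \<preceq>\<^sup>* \<W>)"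

definition covering_uniform_space :: "'a set \<Rightarrow> 'a set set set \<Rightarrow> bool" where
  "covering_uniform_space X \<D> \<longleftrightarrow> X \<noteq> {} \<and> covering_uniformity X \<D>"

definition finite_uniform_coverings :: "'a set set set \<Rightarrow> 'a set set set" where
  "finite_uniform_coverings \<D> = {\<U> \<in> \<D>. finite \<U>}"

definition unif_continuous ::
    "'a set \<Rightarrow> 'a set set set \<Rightarrow> 'b set \<Rightarrow> 'b set set set \<Rightarrow> ('a \<Rightarrow> 'b) \<Rightarrow> bool" where
  "unif_continuous X \<D> Y \<E> f \<longleftrightarrow>
     f \<in> X \<rightarrow> Y \<and> (\<forall>\<U>\<in>\<E>. {f -` U \<inter> X | U. U \<in> \<U>} \<in> \<D>)"

text \<open>Maps \<open>X \<rightarrow> X\<close> are represented by functions that are \<^term>\<open>undefined\<close> outside \<open>X\<close>,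
  as in \<^const>\<open>BijGroup\<close>, so that equality of group elements is equality on \<open>X\<close>.\<close>

definition unif_Aut :: "'a set \<Rightarrow> 'a set set set \<Rightarrow> ('a \<Rightarrow> 'a) monoid" where
  "unif_Aut X \<D> = BijGroup X
     \<lparr>carrier := {g \<in> Bij X. unif_continuous X \<D> X \<D> g \<and>
                          unif_continuous X \<D> X \<D> (inv_into X g)}\<rparr>"

lemma unif_continuous_compose:
  assumes "unif_continuous X \<D> Y \<E> f" "unif_continuous Y \<E> Z \<F> g"
  shows "unif_continuous X \<D> Z \<F> (compose X g f)"
  unfolding unif_continuous_def
proof (intro conjI ballI)
  show "compose X g f \<in> X \<rightarrow> Z"
    using assms by (auto simp: unif_continuous_def compose_def)
  fix \<U> assume "\<U> \<in> \<F>"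
  then have "{g -` U \<inter> Y | U. U \<in> \<U>} \<in> \<E>"
    using assms(2) unfolding unif_continuous_def by blast
  then have "{f -` V \<inter> X | V. V \<in> {g -` U \<inter> Y | U. U \<in> \<U>}} \<in> \<D>"
    using assms(1) unfolding unif_continuous_def by blast
  moreover have "f -` (g -` U \<inter> Y) \<inter> X = compose X g f -` U \<inter> X" for U
    using assms(1) by (auto simp: unif_continuous_def compose_def)
  then have "{f -` V \<inter> X | V. V \<in> {g -` U \<inter> Y | U. U \<in> \<U>}} =
      {compose X g f -` U \<inter> X | U. U \<in> \<U>}"
    by (simp only: Setcompr_eq_image image_image)
  ultimately show "{compose X g f -` U \<inter> X | U. U \<in> \<U>} \<in> \<D>"
    by simp
qed

lemma unif_continuous_cong:
  assumes "\<And>x. x \<in> X \<Longrightarrow> f x = g x"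
  shows "unif_continuous X \<D> Y \<E> f \<longleftrightarrow> unif_continuous X \<D> Y \<E> g"
proof -
  have "f -` U \<inter> X = g -` U \<inter> X" for U
    using assms by auto
  moreover have "f \<in> X \<rightarrow> Y \<longleftrightarrow> g \<in> X \<rightarrow> Y"
    using assms by (simp add: Pi_iff)
  ultimately show ?thesis
    by (simp add: unif_continuous_def)
qed

lemma subgroup_unif_Aut:
  assumes "covering_uniform_space X \<D>"
  shows "subgroup (carrier (unif_Aut X \<D>)) (BijGroup X)"
proof -
  interpret B: group "BijGroup X" by (rule group_BijGroup)
  have cov: "\<U> \<subseteq> Pow X" if "\<U> \<in> \<D>" for \<U>
    using assms that
    by (auto simp: covering_uniform_space_def covering_uniformity_def covering_def)
  have one: "unif_continuous X \<D> X \<D> (\<lambda>x. x)"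
  proof -
    have "{(\<lambda>x. x) -` U \<inter> X | U. U \<in> \<U>} = \<U>" if "\<U> \<in> \<D>" for \<U>
    proof -
      have "(\<lambda>x. x) -` U \<inter> X = U" if "U \<in> \<U>" for U
        using cov[OF \<open>\<U> \<in> \<D>\<close>] that by auto
      then show ?thesis by (simp add: Setcompr_eq_image)
    qed
    then show ?thesis by (simp add: unif_continuous_def)
  qed
  have inv_eq: "unif_continuous X \<D> X \<D> (inv_into X g) \<longleftrightarrow>
      unif_continuous X \<D> X \<D> (inv\<^bsub>BijGroup X\<^esub> g)" if "g \<in> Bij X" for g
    using that by (intro unif_continuous_cong) (simp add: inv_BijGroup)
  have Aut: "carrier (unif_Aut X \<D>) = {g \<in> Bij X. unif_continuous X \<D> X \<D> g \<and>
      unif_continuous X \<D> X \<D> (inv\<^bsub>BijGroup X\<^esub> g)}"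
    using inv_eq by (auto simp: unif_Aut_def)
  have car: "carrier (BijGroup X) = Bij X"
    by (simp add: BijGroup_def)
  show ?thesis
  proof (rule B.subgroupI)
    show "carrier (unif_Aut X \<D>) \<subseteq> carrier (BijGroup X)"
      by (auto simp: Aut car)
    have "\<one>\<^bsub>BijGroup X\<^esub> \<in> carrier (unif_Aut X \<D>)"
      using one B.one_closed unif_continuous_cong[of X "\<lambda>x\<in>X. x" "\<lambda>x. x" \<D> X \<D>]
      by (simp add: Aut car[symmetric]) (simp add: BijGroup_def)
    then show "carrier (unif_Aut X \<D>) \<noteq> {}" by blast
  next
    fix g assume "g \<in> carrier (unif_Aut X \<D>)"
    then show "inv\<^bsub>BijGroup X\<^esub> g \<in> carrier (unif_Aut X \<D>)"
      using B.inv_closed B.inv_inv by (auto simp: Aut car[symmetric])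
  next
    fix g h assume gh: "g \<in> carrier (unif_Aut X \<D>)" "h \<in> carrier (unif_Aut X \<D>)"
    have mult: "a \<otimes>\<^bsub>BijGroup X\<^esub> b = compose X a b" if "a \<in> Bij X" "b \<in> Bij X" for a b
      using that by (simp add: BijGroup_def)
    have inv: "inv\<^bsub>BijGroup X\<^esub> g \<in> Bij X" "inv\<^bsub>BijGroup X\<^esub> h \<in> Bij X"
      using gh B.inv_closed by (auto simp: Aut car[symmetric])
    have "inv\<^bsub>BijGroup X\<^esub> (g \<otimes>\<^bsub>BijGroup X\<^esub> h) =
        inv\<^bsub>BijGroup X\<^esub> h \<otimes>\<^bsub>BijGroup X\<^esub> inv\<^bsub>BijGroup X\<^esub> g"
      using gh by (intro B.inv_mult_group) (auto simp: Aut car)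
    moreover have "g \<otimes>\<^bsub>BijGroup X\<^esub> h \<in> Bij X"
      using gh B.m_closed by (auto simp: Aut car[symmetric])
    ultimately show "g \<otimes>\<^bsub>BijGroup X\<^esub> h \<in> carrier (unif_Aut X \<D>)"
      using gh inv by (auto simp: Aut mult intro: unif_continuous_compose)
  qed
qed

lemma group_unif_Aut:
  assumes "covering_uniform_space X \<D>"
  shows "group (unif_Aut X \<D>)"
  using group.subgroup_imp_group[OF group_BijGroup subgroup_unif_Aut[OF assms]]
  by (simp add: unif_Aut_def)

section \<open>Asymptotic uniform complexity\<close>

definition uniform_complexity :: "'a set set set \<Rightarrow> 'a set set \<Rightarrow> nat" where
  "uniform_complexity \<D> \<U> =
     Inf {card \<V> | \<V>. \<V> \<in> finite_uniform_coverings \<D> \<and> \<U> \<preceq> \<V>}"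

definition asymp_uniform_complexity :: "'a set set set \<Rightarrow> ('a \<Rightarrow> 'a) set \<Rightarrow> ereal" where
  "asymp_uniform_complexity \<D> G =
     (SUP E \<in> {E. finite E \<and> E \<subseteq> G}.
      SUP \<U> \<in> finite_uniform_coverings \<D>.
      INF \<V> \<in> {\<V> \<in> finite_uniform_coverings \<D>. \<U> \<preceq> \<V>}.
      SUP g \<in> E.
        ereal (real (uniform_complexity \<D> (cover_join \<V> ((`) g ` \<V>))) /
               real (uniform_complexity \<D> \<V>)))"

section \<open>Mean topological matching number\<close>

definition matching_number :: "'a set \<Rightarrow> 'a set \<Rightarrow> 'a set set \<Rightarrow> nat" where
  "matching_number E F \<U> =
     Max {card D | D. D \<subseteq> E \<and>
       (\<exists>\<phi>. \<phi> \<in> D \<rightarrow> F \<and> inj_on \<phi> D \<and> (\<forall>x\<in>D. \<exists>U\<in>\<U>. {x, \<phi> x} \<subseteq> U))}"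

definition mean_matching_number ::
    "'a set \<Rightarrow> 'a set set set \<Rightarrow> ('a \<Rightarrow> 'a) set \<Rightarrow> ereal" where
  "mean_matching_number X \<D> G =
     (INF E \<in> {E. finite E \<and> E \<subseteq> G}.
      INF \<U> \<in> finite_uniform_coverings \<D>.
      SUP F \<in> {F. finite F \<and> F \<subseteq> X \<and> F \<noteq> {}}.
      INF g \<in> E.
        ereal (real (matching_number F (g ` F) \<U>) / real (card F)))"

end

theory Submission
  imports Defs
begin

text \<open>
  Write \<open>N(\<V>)\<close> for the uniform complexity. Fix finitely many automorphisms and a finite uniform
  covering \<open>\<U>\<close>. The point is that for every sufficiently fine finite uniform covering \<open>\<V>\<close> there
  is one finite set \<open>F\<close> of \<open>N(\<V>)\<close> points, independent of \<open>g\<close>, with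
  \<open>2 N(\<V>) \<le> N(\<V> \<or> g(\<V>)) + \<mu>(F, g(F), \<U>)\<close>.
  Dividing by \<open>N(\<V>) = |F|\<close>, choosing the \<open>g\<close> with the smallest matching number and passing to
  suprema and infima gives the inequality.

  Let \<open>\<O>\<close> be a refinement of \<open>\<V>\<close> with exactly \<open>N(\<V>)\<close> members. Its minimality is exploited
  through Hall's marriage theorem (\<open>hall_injective_choice\<close>): if a subfamily \<open>S\<close> of \<open>\<O>\<close> had fewer
  candidates than members, then exchanging \<open>S\<close> for its candidates would give a smaller refinement
  of \<open>\<V>\<close>. This yields two injective choices. First, the members of \<open>\<O>\<close> contain distinct points
  (\<open>optimal_refinement_distinct_points\<close>), and these form \<open>F\<close>. Secondly, into every finite uniform
  covering \<open>\<W>\<close> that refines \<open>\<V>\<close> there is an injection from \<open>\<O>\<close> that sends each member to a set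
  meeting it (\<open>optimal_refinement_meets_injectively\<close>).

  Now let \<open>\<W>\<close> be a smallest refinement of \<open>\<V> \<or> g(\<V>)\<close>. Since both \<open>\<W>\<close> and \<open>g\<^sup>-\<^sup>1(\<W>)\<close> refine \<open>\<V>\<close>,
  there are injections \<open>e\<close> and \<open>d\<close> from \<open>\<O>\<close> to \<open>\<W>\<close> such that \<open>e A\<close> meets \<open>A\<close> and \<open>d B\<close> meets
  \<open>g(B)\<close>. The two images have \<open>N(\<V>)\<close> elements each, so they share at least \<open>2 N(\<V>) - |\<W>|\<close>
  sets. A shared set \<open>e A = d B\<close> meets both \<open>A\<close> and \<open>g(B)\<close>; when all these sets are small in a star
  refinement of \<open>\<U>\<close>, the point of \<open>A\<close> and the \<open>g\<close>-image of the point of \<open>B\<close> lie in a common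
  member of \<open>\<U>\<close>. Thus the shared sets define a matching between \<open>F\<close> and \<open>g(F)\<close>.
\<close>

section \<open>Hall's marriage theorem\<close>

text \<open>
  Hall's condition compares a set of indices with the finite sets that contain all its candidates,
  rather than with the number of candidates, so that candidate sets may be infinite. The
  proof is the induction of Halmos and Vaughan: split along a proper set of indices for which the
  condition is tight, and otherwise fix one value greedily.
\<close>

lemma hall_injective_choice:
  assumes "finite I"
    and "\<And>S T. S \<subseteq> I \<Longrightarrow> finite T \<Longrightarrow> (\<Union>i\<in>S. A i) \<subseteq> T \<Longrightarrow> card S \<le> card T"
  shows "\<exists>f. inj_on f I \<and> (\<forall>i\<in>I. f i \<in> A i)"
  using assms
proof (induction "card I" arbitrary: I A rule: less_induct)
  case less
  note hall = less.prems(2)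
  show ?case
  proof (cases "\<exists>S T. S \<subset> I \<and> S \<noteq> {} \<and> finite T \<and> (\<Union>i\<in>S. A i) \<subseteq> T \<and> card S = card T")
    case True
    then obtain S T where S: "S \<subset> I" "S \<noteq> {}" "finite T" "(\<Union>i\<in>S. A i) \<subseteq> T" "card S = card T"
      by blast
    (* Solve S inside T, and the rest outside T: a shortage there would add up with T to a shortage in I. *)
    have finS: "finite S" using S(1) less.prems(1) finite_subset by blast
    have "\<exists>f. inj_on f S \<and> (\<forall>i\<in>S. f i \<in> A i)"
      using S(1) less.prems(1) finS hall by (intro less.hyps) (auto simp: psubset_card_mono)
    then obtain f where f: "inj_on f S" "\<forall>i\<in>S. f i \<in> A i" by blast
    have "\<exists>h. inj_on h (I - S) \<and> (\<forall>i\<in>I - S. h i \<in> A i - T)"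
    proof (intro less.hyps)
      show "card (I - S) < card I"
        using S(1,2) less.prems(1) by (intro psubset_card_mono) auto
      fix S' T' assume *: "S' \<subseteq> I - S" "finite T'" "(\<Union>i\<in>S'. A i - T) \<subseteq> T'"
      have "card (S' \<union> S) \<le> card (T' \<union> T)"
        using * S(1,3,4) by (intro hall) auto
      moreover have "card (S' \<union> S) = card S' + card S"
        using *(1) finS finite_subset[OF *(1)] less.prems(1) by (intro card_Un_disjoint) auto
      moreover have "card (T' \<union> T) \<le> card T' + card T" by (rule card_Un_le)
      ultimately show "card S' \<le> card T'" using S(5) by linarith
    qed (use less.prems(1) in simp)
    then obtain h where h: "inj_on h (I - S)" "\<forall>i\<in>I - S. h i \<in> A i - T" by blast
    have fT: "f i \<in> T" if "i \<in> S" for i using f(2) S(4) that by (meson UN_I subsetD)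
    have "f i \<noteq> h k" if "i \<in> S" "k \<in> I - S" for i k using fT[OF that(1)] h(2) that(2) by auto
    then have "inj_on (\<lambda>i. if i \<in> S then f i else h i) I"
      using f(1) h(1) unfolding inj_on_def by (smt (verit) DiffI)
    then show ?thesis using f(2) h(2) by (intro exI[of _ "\<lambda>i. if i \<in> S then f i else h i"]) auto
  next
    case no_tight: False
    show ?thesis
    proof (cases "I = {}")
      case True
      then show ?thesis by auto
    next
      case False
      (* Without a tight set every nonempty proper subset has a candidate to spare, so any value a for i will do. *)
      then obtain i where i: "i \<in> I" by blast
      have "A i \<noteq> {}" using hall[of "{i}" "{}"] i by auto
      then obtain a where a: "a \<in> A i" by blast
      have "\<exists>h. inj_on h (I - {i}) \<and> (\<forall>k\<in>I - {i}. h k \<in> A k - {a})"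
      proof (intro less.hyps)
        show "card (I - {i}) < card I"
          using i less.prems(1) by (intro psubset_card_mono) auto
        fix S T assume *: "S \<subseteq> I - {i}" "finite T" "(\<Union>k\<in>S. A k - {a}) \<subseteq> T"
        show "card S \<le> card T"
        proof (cases "S = {}")
          case False
          have sub: "(\<Union>k\<in>S. A k) \<subseteq> insert a T" using * by auto
          have "card S \<le> card (insert a T)" using * sub by (intro hall) auto
          moreover have "S \<subset> I" using *(1) i by blast
          then have "card S \<noteq> card (insert a T)"
            using no_tight False sub *(2) by (meson finite_insert)
          ultimately show ?thesis using *(2) by (auto simp: card_insert_if split: if_splits)
        qed auto
      qed (use less.prems(1) in simp)
      then obtain h where h: "inj_on h (I - {i})" "\<forall>k\<in>I - {i}. h k \<in> A k - {a}" by blast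
      have "inj_on (h(i := a)) I" using h by (auto simp: inj_on_def)
      then show ?thesis using h(2) a by (intro exI[of _ "h(i := a)"]) auto
    qed
  qed
qed

section \<open>Refinements and stars\<close>

lemma refined_by_trans: "\<U> \<preceq> \<V> \<Longrightarrow> \<V> \<preceq> \<W> \<Longrightarrow> \<U> \<preceq> \<W>"
  unfolding refined_by_def by (meson subset_trans)

lemma refined_by_refl: "\<U> \<preceq> \<U>"
  unfolding refined_by_def by blast

lemma cover_join_refines: "\<U> \<preceq> cover_join \<U> \<V>" "\<V> \<preceq> cover_join \<U> \<V>"
  unfolding refined_by_def cover_join_def by blast+

lemma finite_cover_join: "finite \<U> \<Longrightarrow> finite \<V> \<Longrightarrow> finite (cover_join \<U> \<V>)"
  unfolding cover_join_def by (rule finite_image_set2) simp_all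

lemma subset_St: "W \<in> \<W> \<Longrightarrow> W \<subseteq> St W \<W>"
  unfolding St_def by blast

lemma star_refined_byE:
  assumes "\<U> \<preceq>\<^sup>* \<W>" "W \<in> \<W>"
  obtains U where "U \<in> \<U>" "St W \<W> \<subseteq> U"
  using assms unfolding star_refined_by_def refined_by_def star_def by blast

section \<open>Matching numbers\<close>

lemma matching_number_ge:
  assumes "finite E" "D \<subseteq> E" "\<phi> \<in> D \<rightarrow> F" "inj_on \<phi> D" "\<And>x. x \<in> D \<Longrightarrow> \<exists>U\<in>\<U>. {x, \<phi> x} \<subseteq> U"
  shows "card D \<le> matching_number E F \<U>"
  unfolding matching_number_def
proof (rule Max_ge)
  have "{card D | D. D \<subseteq> E \<and> P D} \<subseteq> card ` Pow E" for P by blast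
  then show "finite {card D | D. D \<subseteq> E \<and>
       (\<exists>\<phi>. \<phi> \<in> D \<rightarrow> F \<and> inj_on \<phi> D \<and> (\<forall>x\<in>D. \<exists>U\<in>\<U>. {x, \<phi> x} \<subseteq> U))}"
    by (rule finite_subset) (use assms(1) in simp)
qed (use assms in blast)

section \<open>Finite uniform coverings\<close>

locale uniform_cover_space =
  fixes X :: "'a set" and \<D> :: "'a set set set"
  assumes unif: "covering_uniform_space X \<D>"
begin

abbreviation \<N> where "\<N> \<equiv> finite_uniform_coverings \<D>"

lemma X_nonempty: "X \<noteq> {}"
  using unif by (simp add: covering_uniform_space_def)

lemma uniform_covers: assumes "\<U> \<in> \<D>" shows "\<U> \<subseteq> Pow X" "\<Union>\<U> = X" "\<U> \<noteq> {}"
  using unif assms X_nonempty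
  by (auto simp: covering_uniform_space_def covering_uniformity_def covering_def)

text \<open>
  A family coarser than a uniform covering is automatically a covering, so uniformity of a
  modified covering only has to be checked on the members of some uniform covering.
\<close>

lemma coarser_uniform:
  assumes "\<W> \<in> \<D>" "\<U> \<subseteq> Pow X" "\<U> \<preceq> \<W>"
  shows "\<U> \<in> \<D>"
proof -
  have "\<Union>\<W> \<subseteq> \<Union>\<U>" using assms(3) unfolding refined_by_def by blast
  then have "covering X \<U>" using assms(1,2) uniform_covers(2) by (auto simp: covering_def)
  then show ?thesis using unif assms
    unfolding covering_uniform_space_def covering_uniformity_def by blast
qed

lemma star_refinement:
  assumes "\<U> \<in> \<D>" "\<V> \<in> \<D>"
  obtains \<W> where "\<W> \<in> \<D>" "\<U> \<preceq>\<^sup>* \<W>" "\<V> \<preceq>\<^sup>* \<W>"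
  using unif assms unfolding covering_uniform_space_def covering_uniformity_def by blast

lemma cover_join_uniform:
  assumes "\<U> \<in> \<D>" "\<V> \<in> \<D>"
  shows "cover_join \<U> \<V> \<in> \<D>"
proof -
  obtain \<W> where \<W>: "\<W> \<in> \<D>" "\<U> \<preceq>\<^sup>* \<W>" "\<V> \<preceq>\<^sup>* \<W>"
    using star_refinement[OF assms] .
  have "cover_join \<U> \<V> \<preceq> \<W>"
    unfolding refined_by_def
  proof
    fix W assume W: "W \<in> \<W>"
    obtain U where "U \<in> \<U>" "St W \<W> \<subseteq> U" using star_refined_byE[OF \<W>(2) W] .
    moreover obtain V where "V \<in> \<V>" "St W \<W> \<subseteq> V" using star_refined_byE[OF \<W>(3) W] .
    ultimately have "U \<inter> V \<in> cover_join \<U> \<V>" "W \<subseteq> U \<inter> V"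
      using subset_St[OF W] unfolding cover_join_def by auto
    then show "\<exists>A\<in>cover_join \<U> \<V>. W \<subseteq> A" ..
  qed
  moreover have "cover_join \<U> \<V> \<subseteq> Pow X"
    using uniform_covers(1) assms unfolding cover_join_def by blast
  ultimately show ?thesis using \<W>(1) coarser_uniform by blast
qed

lemma cover_join_fin_uniform: "\<U> \<in> \<N> \<Longrightarrow> \<V> \<in> \<N> \<Longrightarrow> cover_join \<U> \<V> \<in> \<N>"
  by (simp add: finite_uniform_coverings_def cover_join_uniform finite_cover_join)

lemma common_refinement:
  assumes "finite \<CC>" "\<CC> \<subseteq> \<N>"
  obtains \<R> where "\<R> \<in> \<N>" "\<forall>\<U>\<in>\<CC>. \<U> \<preceq> \<R>"
proof -
  have "\<exists>\<R>\<in>\<N>. \<forall>\<U>\<in>\<CC>. \<U> \<preceq> \<R>"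
    using assms
  proof (induction rule: finite_induct)
    case empty
    obtain \<U> where \<U>: "\<U> \<in> \<D>"
      using unif by (auto simp: covering_uniform_space_def covering_uniformity_def)
    have "{X} \<preceq> \<U>" using uniform_covers(1)[OF \<U>] by (auto simp: refined_by_def)
    then have "{X} \<in> \<D>" by (intro coarser_uniform[OF \<U>]) simp
    then have "{X} \<in> \<N>" by (simp add: finite_uniform_coverings_def)
    then show ?case by blast
  next
    case (insert \<U> \<CC>)
    then obtain \<R> where \<R>: "\<R> \<in> \<N>" "\<forall>\<V>\<in>\<CC>. \<V> \<preceq> \<R>" by auto
    have "\<forall>\<V>\<in>insert \<U> \<CC>. \<V> \<preceq> cover_join \<U> \<R>"
      using \<R>(2) cover_join_refines[of \<U> \<R>]
        refined_by_trans[OF _ cover_join_refines(2)[of \<R> \<U>]] by simp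
    then show ?case using \<R>(1) insert.prems cover_join_fin_uniform by blast
  qed
  then show thesis using that by blast
qed

text \<open>
  The uniformity provides star refinements, but possibly infinite ones. Sorting the members \<open>W\<close> of
  such a refinement by the sets \<open>U \<in> \<U>\<close> that contain their star gives a finite uniform shrinking
  \<open>K\<close> of \<open>\<U>\<close>. A set of the covering \<open>\<W>\<close> that meets \<open>K U\<close> lies in \<open>U\<close>, hence each
  two-element family \<open>{U, X - K U}\<close> is a uniform covering. In a common refinement of the shrinking and
  of these families, a set that meets a member inside \<open>K U\<close> must lie in \<open>U\<close>.
\<close>

lemma finite_star_refinement:
  assumes "\<U> \<in> \<N>"
  obtains \<Z> where "\<Z> \<in> \<N>" "\<U> \<preceq>\<^sup>* \<Z>"
proof -
  have \<U>: "\<U> \<in> \<D>" "finite \<U>" using assms by (auto simp: finite_uniform_coverings_def)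
  obtain \<W> where \<W>: "\<W> \<in> \<D>" "\<U> \<preceq>\<^sup>* \<W>" using star_refinement[OF \<U>(1) \<U>(1)] .
  define K where "K U = \<Union>{W \<in> \<W>. St W \<W> \<subseteq> U}" for U
  have K_sub: "W \<subseteq> U" if "W \<in> \<W>" "W \<inter> K U \<noteq> {}" for W U
    using that unfolding K_def St_def by blast
  have K_X: "K U \<subseteq> X" for U using uniform_covers(1)[OF \<W>(1)] unfolding K_def by blast
  have "K ` \<U> \<in> \<D>"
  proof (rule coarser_uniform[OF \<W>(1)])
    show "K ` \<U> \<preceq> \<W>" unfolding refined_by_def
    proof
      fix W assume "W \<in> \<W>"
      moreover obtain U where "U \<in> \<U>" "St W \<W> \<subseteq> U"
        using star_refined_byE[OF \<W>(2) \<open>W \<in> \<W>\<close>] .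
      ultimately show "\<exists>A\<in>K ` \<U>. W \<subseteq> A" unfolding K_def by blast
    qed
  qed (use K_X in blast)
  then have K_fin: "K ` \<U> \<in> \<N>" using \<U>(2) by (simp add: finite_uniform_coverings_def)
  have split: "{U, X - K U} \<in> \<N>" if "U \<in> \<U>" for U
  proof -
    have "W \<subseteq> U \<or> W \<subseteq> X - K U" if W: "W \<in> \<W>" for W
      using K_sub[OF W, of U] W uniform_covers(1)[OF \<W>(1)] by auto
    then have "{U, X - K U} \<preceq> \<W>" unfolding refined_by_def by simp
    then have "{U, X - K U} \<in> \<D>"
      using that uniform_covers(1)[OF \<U>(1)] by (intro coarser_uniform[OF \<W>(1)]) auto
    then show ?thesis by (simp add: finite_uniform_coverings_def)
  qed
  let ?\<CC> = "insert (K ` \<U>) ((\<lambda>U. {U, X - K U}) ` \<U>)"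
  have "finite ?\<CC>" using \<U>(2) by simp
  moreover have "?\<CC> \<subseteq> \<N>" using K_fin split by (simp add: image_subset_iff)
  ultimately obtain \<Z> where \<Z>: "\<Z> \<in> \<N>" "\<forall>\<V>\<in>?\<CC>. \<V> \<preceq> \<Z>"
    by (rule common_refinement)
  have \<Z>_K: "K ` \<U> \<preceq> \<Z>" and \<Z>_split: "\<And>U. U \<in> \<U> \<Longrightarrow> {U, X - K U} \<preceq> \<Z>"
    using \<Z>(2) by simp_all
  have "\<U> \<preceq>\<^sup>* \<Z>" unfolding star_refined_by_def refined_by_def star_def
  proof clarify
    fix Z assume "Z \<in> \<Z>"
    then obtain U where U: "U \<in> \<U>" "Z \<subseteq> K U" using \<Z>_K unfolding refined_by_def by blast
    have "Z' \<subseteq> U" if "Z' \<in> \<Z>" "Z' \<inter> Z \<noteq> {}" for Z'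
    proof -
      have "Z' \<subseteq> U \<or> Z' \<subseteq> X - K U"
        using \<Z>_split[OF U(1)] that(1) unfolding refined_by_def by simp
      then show ?thesis using that(2) U(2) by blast
    qed
    then have "St Z \<Z> \<subseteq> U" unfolding St_def by blast
    then show "\<exists>U\<in>\<U>. St Z \<Z> \<subseteq> U" using U(1) by blast
  qed
  with \<Z>(1) show thesis by (rule that)
qed

section \<open>Optimal refinements\<close>

lemma complexity_le: "\<V> \<in> \<N> \<Longrightarrow> \<U> \<preceq> \<V> \<Longrightarrow> uniform_complexity \<D> \<U> \<le> card \<V>"
  unfolding uniform_complexity_def by (rule cInf_lower) auto

lemma complexity_attained:
  assumes "\<U> \<in> \<N>"
  obtains \<V> where "\<V> \<in> \<N>" "\<U> \<preceq> \<V>" "card \<V> = uniform_complexity \<D> \<U>"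
proof -
  let ?C = "{card \<V> | \<V>. \<V> \<in> \<N> \<and> \<U> \<preceq> \<V>}"
  have "card \<U> \<in> ?C" using assms refined_by_refl[of \<U>] by auto
  then have "Inf ?C \<in> ?C" by (intro Inf_nat_def1) auto
  then obtain \<V> where "Inf ?C = card \<V>" "\<V> \<in> \<N>" "\<U> \<preceq> \<V>" by auto
  then show thesis using that unfolding uniform_complexity_def by simp
qed

text \<open>
  Hall's condition for the relation \<open>meets\<close>: replace a subfamily \<open>S\<close> of \<open>\<V>\<close> by the members of
  \<open>\<W>\<close> that meet some set of \<open>S\<close>. The result is still a uniform covering that refines \<open>\<U>\<close>, because
  every nonempty intersection \<open>V \<inter> W\<close> lies either in \<open>V \<notin> S\<close> or in such a \<open>W\<close>. By
  minimality of \<open>\<V>\<close> this replacement cannot have fewer members.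
\<close>

lemma optimal_refinement_meets_injectively:
  assumes \<V>: "\<V> \<in> \<N>" "\<U> \<preceq> \<V>" "card \<V> = uniform_complexity \<D> \<U>"
    and \<W>: "\<W> \<in> \<N>" "\<U> \<preceq> \<W>"
  obtains e where "inj_on e \<V>" "\<And>V. V \<in> \<V> \<Longrightarrow> e V \<in> \<W>" "\<And>V. V \<in> \<V> \<Longrightarrow> e V \<inter> V \<noteq> {}"
proof -
  have D: "\<V> \<in> \<D>" "\<W> \<in> \<D>" and fin: "finite \<V>" "finite \<W>"
    using \<V>(1) \<W>(1) by (auto simp: finite_uniform_coverings_def)
  have "\<exists>e. inj_on e \<V> \<and> (\<forall>V\<in>\<V>. e V \<in> {W \<in> \<W>. W \<inter> V \<noteq> {}})"
  proof (rule hall_injective_choice[OF fin(1)])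
    fix S T assume *: "S \<subseteq> \<V>" "finite T" "(\<Union>V\<in>S. {W \<in> \<W>. W \<inter> V \<noteq> {}}) \<subseteq> T"
    let ?\<A> = "(\<V> - S) \<union> (T \<inter> \<W>)"
    have sub: "?\<A> \<subseteq> Pow X" using uniform_covers(1) D by blast
    have mem: "\<exists>A\<in>?\<A>. V \<inter> W \<subseteq> A" if "V \<in> \<V>" "W \<in> \<W>" "V \<inter> W \<noteq> {}" for V W
      using that * by (cases "V \<in> S") auto
    have "\<Union>\<V> = X" "\<Union>\<W> = X" using uniform_covers(2) D by auto
    then have "?\<A> \<noteq> {}" using mem X_nonempty by blast
    then have "?\<A> \<preceq> cover_join \<V> \<W>"
      using mem unfolding refined_by_def cover_join_def by blast
    then have "?\<A> \<in> \<N>"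
      using coarser_uniform[OF cover_join_uniform[OF D] sub] fin
      by (simp add: finite_uniform_coverings_def)
    moreover have "\<U> \<preceq> ?\<A>" using \<V>(2) \<W>(2) unfolding refined_by_def by blast
    ultimately have "card \<V> \<le> card ?\<A>" using complexity_le \<V>(3) by simp
    also have "\<dots> \<le> card (\<V> - S) + card (T \<inter> \<W>)" by (rule card_Un_le)
    also have "\<dots> \<le> (card \<V> - card S) + card T"
      using *(1,2) fin(1) by (intro add_mono card_mono) (auto simp: card_Diff_subset finite_subset)
    finally show "card S \<le> card T" using card_mono[OF fin(1) *(1)] by linarith
  qed
  then show thesis using that by blast
qed

text \<open>
  Hall's condition for the relation \<open>contains\<close>: if the union of a subfamily \<open>S\<close> of \<open>\<V>\<close> lies in
  the finite set \<open>T\<close>, then \<open>S\<close> can be replaced by one set \<open>v x \<in> \<V>\<close> for each \<open>x \<in> T\<close>, chosen to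
  contain all members of a star refinement \<open>\<W>\<close> that contain \<open>x\<close>. The nonempty members of \<open>\<W>\<close> inside a set of \<open>S\<close>
  touch \<open>T\<close>, so the new family is still coarser than \<open>\<W>\<close> and therefore uniform.
\<close>

lemma optimal_refinement_distinct_points:
  assumes \<V>: "\<V> \<in> \<N>" "\<U> \<preceq> \<V>" "card \<V> = uniform_complexity \<D> \<U>"
  obtains p where "inj_on p \<V>" "\<And>V. V \<in> \<V> \<Longrightarrow> p V \<in> V"
proof -
  have D: "\<V> \<in> \<D>" and fin: "finite \<V>"
    using \<V>(1) by (auto simp: finite_uniform_coverings_def)
  have "\<exists>p. inj_on p \<V> \<and> (\<forall>V\<in>\<V>. p V \<in> V)"
  proof (rule hall_injective_choice[OF fin])
    fix S T assume *: "S \<subseteq> \<V>" "finite T" "(\<Union>V\<in>S. V) \<subseteq> T"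
    obtain \<W> where \<W>: "\<W> \<in> \<D>" "\<V> \<preceq>\<^sup>* \<W>" using star_refinement[OF D D] .
    have "\<exists>V\<in>\<V>. \<forall>W\<in>\<W>. x \<in> W \<longrightarrow> W \<subseteq> V" if "x \<in> X" for x
    proof -
      have "x \<in> \<Union>\<W>" using that uniform_covers(2)[OF \<W>(1)] by simp
      then obtain W where W: "W \<in> \<W>" "x \<in> W" by (rule UnionE)
      obtain V where "V \<in> \<V>" "St W \<W> \<subseteq> V" using star_refined_byE[OF \<W>(2) W(1)] .
      then show ?thesis using W(2) unfolding St_def by blast
    qed
    then obtain v where v: "\<And>x. x \<in> X \<Longrightarrow> v x \<in> \<V>"
      "\<And>x W. x \<in> X \<Longrightarrow> W \<in> \<W> \<Longrightarrow> x \<in> W \<Longrightarrow> W \<subseteq> v x" by metis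
    let ?\<A> = "(\<V> - S) \<union> v ` (T \<inter> X)"
    have sub\<V>: "?\<A> \<subseteq> \<V>" using v(1) by blast
    then have sub: "?\<A> \<subseteq> Pow X" using uniform_covers(1)[OF D] by (rule subset_trans)
    have mem: "\<exists>A\<in>?\<A>. W \<subseteq> A" if W: "W \<in> \<W>" "W \<noteq> {}" for W
    proof -
      obtain V where V: "V \<in> \<V>" "St W \<W> \<subseteq> V" using star_refined_byE[OF \<W>(2) W(1)] .
      have WV: "W \<subseteq> V" using subset_St[OF W(1)] V(2) by (rule subset_trans)
      show ?thesis
      proof (cases "V \<in> S")
        case True
        obtain x where x: "x \<in> W" using W(2) by blast
        have "V \<subseteq> T" "V \<subseteq> X" using True *(3) V(1) uniform_covers(1)[OF D] by auto
        then have xTX: "x \<in> T \<inter> X" using x WV by auto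
        then have "W \<subseteq> v x" using v(2) W(1) x by simp
        then show ?thesis using xTX by auto
      next
        case False
        then show ?thesis using V(1) WV by auto
      qed
    qed
    have "\<exists>W\<in>\<W>. W \<noteq> {}" using X_nonempty uniform_covers(2)[OF \<W>(1)] by auto
    then have "?\<A> \<noteq> {}" using mem by auto
    then have "?\<A> \<preceq> \<W>" using mem unfolding refined_by_def by (metis empty_subsetI ex_in_conv)
    then have "?\<A> \<in> \<N>"
      using coarser_uniform[OF \<W>(1) sub] finite_subset[OF sub\<V> fin]
      by (simp add: finite_uniform_coverings_def)
    moreover have "\<U> \<preceq> ?\<A>" using \<V>(2) sub\<V> unfolding refined_by_def by blast
    ultimately have "card \<V> \<le> card ?\<A>" using complexity_le \<V>(3) by simp
    also have "\<dots> \<le> card (\<V> - S) + card (v ` (T \<inter> X))" by (rule card_Un_le)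
    also have "\<dots> \<le> (card \<V> - card S) + card T"
    proof (rule add_mono)
      show "card (\<V> - S) \<le> card \<V> - card S"
        using *(1) fin by (simp add: card_Diff_subset finite_subset)
      have "card (v ` (T \<inter> X)) \<le> card (T \<inter> X)" using *(2) by (intro card_image_le) auto
      also have "\<dots> \<le> card T" using *(2) by (intro card_mono) auto
      finally show "card (v ` (T \<inter> X)) \<le> card T" .
    qed
    finally show "card S \<le> card T" using card_mono[OF fin *(1)] by linarith
  qed
  then show thesis using that by blast
qed

section \<open>Automorphisms\<close>

lemma aut_bij: "g \<in> carrier (unif_Aut X \<D>) \<Longrightarrow> bij_betw g X X"
  by (auto simp: unif_Aut_def Bij_def)

lemma aut_preimage_uniform:
  assumes "g \<in> carrier (unif_Aut X \<D>)" "\<U> \<in> \<N>"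
  shows "(\<lambda>U. g -` U \<inter> X) ` \<U> \<in> \<N>"
proof -
  have "{g -` U \<inter> X | U. U \<in> \<U>} \<in> \<D>"
    using assms by (auto simp: unif_Aut_def unif_continuous_def finite_uniform_coverings_def)
  then show ?thesis
    using assms(2) by (simp add: finite_uniform_coverings_def Setcompr_eq_image)
qed

lemma aut_image_uniform:
  assumes g: "g \<in> carrier (unif_Aut X \<D>)" and \<U>: "\<U> \<in> \<N>"
  shows "(`) g ` \<U> \<in> \<N>"
proof -
  have "{inv_into X g -` U \<inter> X | U. U \<in> \<U>} \<in> \<D>"
    using assms by (auto simp: unif_Aut_def unif_continuous_def finite_uniform_coverings_def)
  moreover have "inv_into X g -` U \<inter> X = g ` U" if "U \<in> \<U>" for U
  proof -
    have "U \<subseteq> X" using that \<U> uniform_covers(1) by (auto simp: finite_uniform_coverings_def)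
    then show ?thesis using aut_bij[OF g]
      by (force simp: bij_betw_def f_inv_into_f inv_into_f_f subset_iff)
  qed
  then have "{inv_into X g -` U \<inter> X | U. U \<in> \<U>} = (`) g ` \<U>"
    by (auto simp: Setcompr_eq_image cong: image_cong)
  ultimately show ?thesis using \<U> by (simp add: finite_uniform_coverings_def)
qed

section \<open>The complexity of a join and matchings\<close>

text \<open>
  This is the counting argument at the heart of the inequality. The chain
  \<open>A\<close>, \<open>e A = d B\<close>, \<open>g(B)\<close> of consecutively meeting \<open>\<Z>\<close>-small sets is contained in one star of \<open>\<Z>\<close>,
  and hence in a member of \<open>\<U>\<close>.
\<close>

lemma twice_complexity_le_join_plus_matching:
  assumes g: "g \<in> carrier (unif_Aut X \<D>)"
    and \<Z>: "\<U> \<preceq>\<^sup>* \<Z>"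
    and \<V>: "\<V> \<in> \<N>" "\<Z> \<preceq> \<V>" "\<Z> \<preceq> (`) g ` \<V>"
    and \<O>: "\<O> \<in> \<N>" "\<V> \<preceq> \<O>" "card \<O> = uniform_complexity \<D> \<V>"
    and p: "inj_on p \<O>" "\<And>A. A \<in> \<O> \<Longrightarrow> p A \<in> A"
  shows "2 * uniform_complexity \<D> \<V> \<le> uniform_complexity \<D> (cover_join \<V> ((`) g ` \<V>))
           + matching_number (p ` \<O>) (g ` p ` \<O>) \<U>"
proof -
  have bij: "bij_betw g X X" using aut_bij[OF g] .
  have fin\<O>: "finite \<O>" and \<O>X: "\<O> \<subseteq> Pow X"
    using \<O>(1) uniform_covers(1) by (auto simp: finite_uniform_coverings_def)
  obtain \<W> where \<W>: "\<W> \<in> \<N>" "cover_join \<V> ((`) g ` \<V>) \<preceq> \<W>"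
    and card\<W>: "card \<W> = uniform_complexity \<D> (cover_join \<V> ((`) g ` \<V>))"
    using complexity_attained[OF cover_join_fin_uniform[OF \<V>(1) aut_image_uniform[OF g \<V>(1)]]] .
  have fin\<W>: "finite \<W>" and \<W>X: "\<W> \<subseteq> Pow X"
    using \<W>(1) uniform_covers(1) by (auto simp: finite_uniform_coverings_def)
  have \<V>\<W>: "\<V> \<preceq> \<W>" and g\<V>\<W>: "(`) g ` \<V> \<preceq> \<W>"
    using cover_join_refines \<W>(2) refined_by_trans by blast+
  obtain e where e: "inj_on e \<O>" "\<And>A. A \<in> \<O> \<Longrightarrow> e A \<in> \<W>" "\<And>A. A \<in> \<O> \<Longrightarrow> e A \<inter> A \<noteq> {}"
    using optimal_refinement_meets_injectively[OF \<O> \<W>(1) \<V>\<W>] by blast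
  (* An injection from the sets g(A) to \<W> is found by pulling \<W> back along g, where the same minimality of \<O>
     applies, and pushing the result forward again. *)
  let ?\<W>' = "(\<lambda>W. g -` W \<inter> X) ` \<W>"
  have "\<V> \<preceq> ?\<W>'" unfolding refined_by_def
  proof
    fix W' assume "W' \<in> ?\<W>'"
    then obtain W where W: "W \<in> \<W>" "W' = g -` W \<inter> X" by blast
    obtain V where V: "V \<in> \<V>" "W \<subseteq> g ` V" using g\<V>\<W> W(1) unfolding refined_by_def by blast
    have "V \<subseteq> X" using V(1) \<V>(1) uniform_covers(1) by (auto simp: finite_uniform_coverings_def)
    have "W' \<subseteq> V"
    proof
      fix x assume "x \<in> W'"
      then have x: "x \<in> X" "g x \<in> g ` V" using W(2) V(2) by auto
      then show "x \<in> V"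
        using inj_on_image_mem_iff[of g X x V] bij \<open>V \<subseteq> X\<close> by (simp add: bij_betw_def)
    qed
    then show "\<exists>V\<in>\<V>. W' \<subseteq> V" using V(1) by blast
  qed
  then obtain e' where e': "inj_on e' \<O>" "\<And>A. A \<in> \<O> \<Longrightarrow> e' A \<in> ?\<W>'" "\<And>A. A \<in> \<O> \<Longrightarrow> e' A \<inter> A \<noteq> {}"
    using optimal_refinement_meets_injectively[OF \<O> aut_preimage_uniform[OF g \<W>(1)]] by blast
  define d where "d A = g ` e' A" for A
  have d_mem: "d A \<in> \<W>" if A: "A \<in> \<O>" for A
  proof -
    obtain W where W: "W \<in> \<W>" "e' A = g -` W \<inter> X" using e'(2)[OF A] by blast
    have "W \<subseteq> g ` X" using W(1) \<W>X bij by (auto simp: bij_betw_def)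
    then have "g ` (g -` W \<inter> X) = W" by blast
    then show ?thesis using W by (simp add: d_def)
  qed
  have e'X: "e' A \<subseteq> X" if "A \<in> \<O>" for A using e'(2)[OF that] by blast
  have d_inj: "inj_on d \<O>"
  proof (rule inj_onI)
    fix A B assume AB: "A \<in> \<O>" "B \<in> \<O>" "d A = d B"
    then have "e' A = e' B"
      using inj_on_image_eq_iff[of g X "e' A" "e' B"] bij e'X by (auto simp: d_def bij_betw_def)
    then show "A = B" using e'(1) AB by (auto dest: inj_onD)
  qed
  have d_meets: "d A \<inter> g ` A \<noteq> {}" if "A \<in> \<O>" for A
    using e'(3)[OF that] unfolding d_def by blast
  (* m A is the partner B of A, that is the member of \<O> with e A = d B. *)
  define M where "M = {A \<in> \<O>. e A \<in> d ` \<O>}"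
  define m where "m A = inv_into \<O> d (e A)" for A
  have m: "m A \<in> \<O>" "d (m A) = e A" if "A \<in> M" for A
    using that by (auto simp: M_def m_def inv_into_into f_inv_into_f)
  have "card (e ` \<O>) + card (d ` \<O>) = card (e ` \<O> \<union> d ` \<O>) + card (e ` \<O> \<inter> d ` \<O>)"
    using fin\<O> by (intro card_Un_Int) auto
  moreover have "card (e ` \<O> \<union> d ` \<O>) \<le> card \<W>"
    using fin\<W> e(2) d_mem by (intro card_mono) auto
  moreover have "e ` \<O> \<inter> d ` \<O> = e ` M" by (auto simp: M_def)
  moreover have "card (e ` M) = card M"
    using e(1) by (intro card_image) (auto simp: M_def inj_on_def)
  ultimately have count: "2 * card \<O> \<le> card \<W> + card M"
    using card_image[OF e(1)] card_image[OF d_inj] by simp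
  define q where "q = inv_into \<O> p"
  have q: "q (p A) = A" if "A \<in> \<O>" for A using that p(1) by (simp add: q_def)
  have M\<O>: "M \<subseteq> \<O>" by (auto simp: M_def)
  have "card (p ` M) \<le> matching_number (p ` \<O>) (g ` p ` \<O>) \<U>"
  proof (rule matching_number_ge[where \<phi> = "\<lambda>x. g (p (m (q x)))"])
    show "finite (p ` \<O>)" using fin\<O> by simp
    show "p ` M \<subseteq> p ` \<O>" using M\<O> by blast
    show "(\<lambda>x. g (p (m (q x)))) \<in> p ` M \<rightarrow> g ` p ` \<O>" using q M\<O> m(1) by auto
    have "A = B" if "A \<in> M" "B \<in> M" "g (p (m A)) = g (p (m B))" for A B
    proof -
      have "p (m A) \<in> X" "p (m B) \<in> X" using m(1) p(2) \<O>X that by blast+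
      then have "p (m A) = p (m B)" using that(3) bij by (auto simp: bij_betw_def inj_on_def)
      then have "m A = m B" using p(1) m(1) that by (auto dest: inj_onD)
      then have "e A = e B" using m(2) that by metis
      then show "A = B" using e(1) that M\<O> by (auto dest: inj_onD)
    qed
    then show "inj_on (\<lambda>x. g (p (m (q x)))) (p ` M)" using q M\<O> by (auto simp: inj_on_def subset_iff)
    fix x assume "x \<in> p ` M"
    then obtain A where A: "A \<in> M" "x = p A" by blast
    have A\<O>: "A \<in> \<O>" using A M\<O> by blast
    let ?B = "m A"
    have B: "?B \<in> \<O>" using m(1) A by blast
    have \<Z>\<W>: "\<Z> \<preceq> \<W>" using refined_by_trans[OF \<V>(2) \<V>\<W>] .
    have \<Z>\<O>: "\<Z> \<preceq> \<O>" using refined_by_trans[OF \<V>(2) \<O>(2)] .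
    obtain Z where Z: "Z \<in> \<Z>" "e A \<subseteq> Z" using \<Z>\<W> e(2)[OF A\<O>] unfolding refined_by_def by blast
    obtain Z1 where Z1: "Z1 \<in> \<Z>" "A \<subseteq> Z1" using \<Z>\<O> A\<O> unfolding refined_by_def by blast
    obtain V where V: "V \<in> \<V>" "?B \<subseteq> V" using \<O>(2) B unfolding refined_by_def by blast
    obtain Z2 where Z2: "Z2 \<in> \<Z>" "g ` V \<subseteq> Z2" using \<V>(3) V(1) unfolding refined_by_def by blast
    have "Z1 \<inter> Z \<noteq> {}" using e(3)[OF A\<O>] Z Z1 by blast
    moreover have "Z2 \<inter> Z \<noteq> {}" using d_meets[OF B] m(2)[OF A(1)] Z(2) V(2) Z2(2) by blast
    ultimately have "Z1 \<union> Z2 \<subseteq> St Z \<Z>" using Z1(1) Z2(1) unfolding St_def by blast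
    moreover obtain U where "U \<in> \<U>" "St Z \<Z> \<subseteq> U" using star_refined_byE[OF \<Z> Z(1)] .
    moreover have "x \<in> Z1" using A(2) p(2)[OF A\<O>] Z1(2) by blast
    moreover have "g (p (m (q x))) \<in> Z2" using A(2) q[OF A\<O>] p(2)[OF B] V(2) Z2(2) by auto
    ultimately show "\<exists>U\<in>\<U>. {x, g (p (m (q x)))} \<subseteq> U" by blast
  qed
  moreover have "card (p ` M) = card M" using p(1) M\<O> by (intro card_image) (rule inj_on_subset)
  ultimately show ?thesis using count card\<W> \<O>(3) by linarith
qed

end

theorem theorem6p3:
  fixes X :: "'a set" and \<D> :: "'a set set set" and G :: "('a \<Rightarrow> 'a) set"
  assumes "covering_uniform_space X \<D>"
    and "subgroup G (unif_Aut X \<D>)"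
  shows "asymp_uniform_complexity \<D> G \<ge> 2 - mean_matching_number X \<D> G"
proof -
  interpret uniform_cover_space X \<D> by unfold_locales (rule assms(1))
  let ?\<omega> = "asymp_uniform_complexity \<D> G" and ?\<mu> = "mean_matching_number X \<D> G"
  let ?N = "uniform_complexity \<D>"
  (* With 2 - \<omega> on the left, the infima defining \<mu> can be treated one index at a time. *)
  have exchange: "2 - a \<le> b \<longleftrightarrow> 2 - b \<le> a" for a b :: ereal
    by (cases a; cases b) (auto simp: numeral_eq_ereal)
  have "2 - ?\<omega> \<le> ?\<mu>"
    unfolding mean_matching_number_def
  proof (intro INF_greatest)
    fix E \<U> assume "E \<in> {E. finite E \<and> E \<subseteq> G}" and \<U>: "\<U> \<in> \<N>"
    then have E: "finite E" "E \<subseteq> G" by auto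
    define s where "s = (SUP F \<in> {F. finite F \<and> F \<subseteq> X \<and> F \<noteq> {}}. INF g \<in> E.
        ereal (real (matching_number F (g ` F) \<U>) / real (card F)))"
    have aut: "g \<in> carrier (unif_Aut X \<D>)" if "g \<in> E" for g
      using that E(2) assms(2) subgroup.subset by blast
    obtain \<Z> where \<Z>: "\<Z> \<in> \<N>" "\<U> \<preceq>\<^sup>* \<Z>" using finite_star_refinement[OF \<U>] .
    let ?\<CC> = "insert \<Z> ((\<lambda>g. (\<lambda>Z. g -` Z \<inter> X) ` \<Z>) ` E)"
    have "finite ?\<CC>" using E(1) by simp
    moreover have "?\<CC> \<subseteq> \<N>" using \<Z>(1) aut_preimage_uniform[OF aut \<Z>(1)] by (simp add: image_subset_iff)
    ultimately obtain \<R> where \<R>: "\<R> \<in> \<N>" "\<forall>\<C>\<in>?\<CC>. \<C> \<preceq> \<R>"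
      by (rule common_refinement)
    have \<R>_\<Z>: "\<Z> \<preceq> \<R>" and \<R>_g: "\<And>g. g \<in> E \<Longrightarrow> (\<lambda>Z. g -` Z \<inter> X) ` \<Z> \<preceq> \<R>"
      using \<R>(2) by simp_all
    (* The covering \<R> is the scale from which on the counting argument applies: if \<V> refines \<R>, then both \<V>
       and all g(\<V>) with g in E consist of \<Z>-small sets. *)
    have "2 - s \<le> (SUP g \<in> E. ereal (real (?N (cover_join \<V> ((`) g ` \<V>))) / real (?N \<V>)))"
      if \<V>: "\<V> \<in> \<N>" "\<R> \<preceq> \<V>" for \<V>
    proof (cases "E = {}")
      case True
      (* The infimum over the empty set is \<infinity>, which makes the left-hand side -\<infinity>. *)
      obtain x where "x \<in> X" using X_nonempty by blast
      then have "\<infinity> \<le> s"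
        unfolding s_def True by (intro SUP_upper2[of "{x}"]) (auto simp: top_ereal_def)
      then have "s = \<infinity>" by simp
      then show ?thesis by simp
    next
      case False
      obtain \<O> where \<O>: "\<O> \<in> \<N>" "\<V> \<preceq> \<O>" "card \<O> = ?N \<V>" using complexity_attained[OF \<V>(1)] .
      obtain p where p: "inj_on p \<O>" "\<And>A. A \<in> \<O> \<Longrightarrow> p A \<in> A"
        using optimal_refinement_distinct_points[OF \<O>] by blast
      let ?F = "p ` \<O>"
      have \<O>D: "\<O> \<in> \<D>" "finite \<O>" using \<O>(1) by (auto simp: finite_uniform_coverings_def)
      have F: "finite ?F" "?F \<subseteq> X" "?F \<noteq> {}" "card ?F = ?N \<V>"
        using \<O>D uniform_covers[OF \<O>D(1)] p card_image[OF p(1)] \<O>(3) by auto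
      have pos: "?N \<V> > 0" using F by (metis card_gt_0_iff)
      (* The set F was chosen before g; so g may be taken to minimise the matching number of F and g(F). *)
      define r where "r g = ereal (real (matching_number ?F (g ` ?F) \<U>) / real (card ?F))" for g
      have "Inf (r ` E) = Min (r ` E)" using E(1) False by (intro cInf_eq_Min) auto
      also have "\<dots> \<in> r ` E" using E(1) False by (intro Min_in) auto
      finally obtain g where g: "g \<in> E" "r g = Inf (r ` E)" by auto
      have "Inf (r ` E) \<le> s"
        unfolding s_def r_def by (rule SUP_upper2[of ?F]) (use F in auto)
      then have rs: "r g \<le> s" using g(2) by simp
      have "\<Z> \<preceq> \<V>" using refined_by_trans[OF \<R>_\<Z> \<V>(2)] .
      moreover have "\<Z> \<preceq> (`) g ` \<V>" unfolding refined_by_def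
      proof
        fix A assume "A \<in> (`) g ` \<V>"
        then obtain V where V: "V \<in> \<V>" "A = g ` V" by blast
        have "(\<lambda>Z. g -` Z \<inter> X) ` \<Z> \<preceq> \<V>"
          using refined_by_trans[OF \<R>_g[OF g(1)] \<V>(2)] .
        then obtain Z where "Z \<in> \<Z>" "V \<subseteq> g -` Z \<inter> X" using V(1) unfolding refined_by_def by blast
        then show "\<exists>Z\<in>\<Z>. A \<subseteq> Z" using V(2) by blast
      qed
      ultimately have "2 * ?N \<V> \<le> ?N (cover_join \<V> ((`) g ` \<V>)) + matching_number ?F (g ` ?F) \<U>"
        using twice_complexity_le_join_plus_matching[OF aut[OF g(1)] \<Z>(2) \<V>(1) _ _ \<O> p] by blast
      then have "2 * real (?N \<V>) \<le> real (?N (cover_join \<V> ((`) g ` \<V>)))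
          + real (matching_number ?F (g ` ?F) \<U>)"
        by linarith
      then have "2 \<le> (real (?N (cover_join \<V> ((`) g ` \<V>)))
          + real (matching_number ?F (g ` ?F) \<U>)) / real (?N \<V>)"
        using pos by (simp add: pos_le_divide_eq)
      then have "2 - real (matching_number ?F (g ` ?F) \<U>) / real (?N \<V>)
          \<le> real (?N (cover_join \<V> ((`) g ` \<V>))) / real (?N \<V>)"
        by (simp add: add_divide_distrib)
      then have "2 - r g \<le> ereal (real (?N (cover_join \<V> ((`) g ` \<V>))) / real (?N \<V>))"
        by (simp add: r_def F(4) numeral_eq_ereal)
      moreover have "2 - s \<le> 2 - r g" using rs by (intro ereal_minus_mono) auto
      ultimately show ?thesis using g(1) by (meson SUP_upper2 order_trans)
    qed
    then have "2 - s \<le> (INF \<V> \<in> {\<V> \<in> \<N>. \<R> \<preceq> \<V>}. SUP g \<in> E.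
        ereal (real (?N (cover_join \<V> ((`) g ` \<V>))) / real (?N \<V>)))"
      by (intro INF_greatest) auto
    also have "\<dots> \<le> ?\<omega>"
      unfolding asymp_uniform_complexity_def
      using E \<R>(1) by (intro SUP_upper2[of E] SUP_upper) auto
    finally show "2 - ?\<omega> \<le> (SUP F \<in> {F. finite F \<and> F \<subseteq> X \<and> F \<noteq> {}}. INF g \<in> E.
        ereal (real (matching_number F (g ` F) \<U>) / real (card F)))"
      using exchange unfolding s_def by blast
  qed
  then show ?thesis using exchange by blast
qed

end
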